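(* For all positive integers $n, k$, we have $d(nk-1) \geq d(n-1)$.
   Context: For a finite simple graph $G=(V,E)$ and $v \in V$, let $N[v]$ be the closed neighborhood of $v$. Define the map $\Phi_G$ on subsets of $V$ by $\Phi_G(S) = \{v \in V : \lvert N[v]\cap S\rvert \text{ is odd}\}$; it is linear over $\mathbb{F}_2$ when subsets are identified with vectors in $\mathbb{F}_2^V$ (with symmetric difference as addition). For $m \geq 1$, $d(m)$ denotes $\dim_{\mathbb{F}_2} \ker \Phi_G$ where $G$ is the $m \times m$ grid graph (vertices are the cells of an $m\times m$ array, adjacent when they share a side); the empty $0\times 0$ grid has $d(0)=0$. *)

theory Defs
  imports
    "Graph_Theory.Pair_Digraph"
    "HOL-Library.Z2"
    "HOL-Library.Function_Algebras"
begin

text \<open>Finite simple graphs are symmetric loop-free pair digraphs (locale \<open>pair_graph\<close>).\<close>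

definition closed_nbhd :: "'a pair_pre_digraph \<Rightarrow> 'a \<Rightarrow> 'a set" where
  "closed_nbhd G v = insert v {u. (v, u) \<in> parcs G}"

definition Phi :: "'a pair_pre_digraph \<Rightarrow> 'a set \<Rightarrow> 'a set" where
  "Phi G S = {v \<in> pverts G. odd (card (closed_nbhd G v \<inter> S))}"

definition ker_Phi :: "'a pair_pre_digraph \<Rightarrow> 'a set set" where
  "ker_Phi G = {S. S \<subseteq> pverts G \<and> Phi G S = {}}"

text \<open>
  A vector in \<open>\<bbbF>\<^sub>2\<^sup>V\<close> is a function into the two-element field \<open>bit\<close> that vanishes outside \<open>V\<close>;
  a subset of \<open>V\<close> is identified with its characteristic vector.
\<close>

definition char_vec :: "'a set \<Rightarrow> 'a \<Rightarrow> bit" where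
  "char_vec S = (\<lambda>x. of_bool (x \<in> S))"

definition scale2 :: "bit \<Rightarrow> ('a \<Rightarrow> bit) \<Rightarrow> 'a \<Rightarrow> bit" where
  "scale2 c f = (\<lambda>x. c * f x)"

interpretation F2: vector_space scale2
  by unfold_locales (auto simp: scale2_def fun_eq_iff algebra_simps)

definition grid_graph :: "nat \<Rightarrow> (nat \<times> nat) pair_pre_digraph" where
  "grid_graph m = \<lparr> pverts = {1..m} \<times> {1..m},
     parcs = {((i, j), (i', j')). (i, j) \<in> {1..m} \<times> {1..m} \<and> (i', j') \<in> {1..m} \<times> {1..m} \<and>
       (i = i' \<and> (j' = j + 1 \<or> j = j' + 1) \<or> j = j' \<and> (i' = i + 1 \<or> i = i' + 1))} \<rparr>"

definition d :: "nat \<Rightarrow> nat" where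
  "d m = F2.dim (char_vec ` ker_Phi (grid_graph m))"

lemma pair_graph_grid_graph: "pair_graph (grid_graph m)"
proof -
  have "parcs (grid_graph m) \<subseteq> ({1..m} \<times> {1..m}) \<times> ({1..m} \<times> {1..m})"
    by (auto simp: grid_graph_def)
  then have "finite (parcs (grid_graph m))"
    by (rule finite_subset) auto
  then show ?thesis
    by unfold_locales (auto simp: grid_graph_def symmetric_def arcs_ends_def arc_to_ends_def intro!: symI)
qed

lemma char_vec_sym_diff: "char_vec (sym_diff S T) = char_vec S + char_vec T"
  by (auto simp: char_vec_def fun_eq_iff)

lemma Phi_sym_diff:
  assumes "finite S" "finite T"
  shows "Phi G (sym_diff S T) = sym_diff (Phi G S) (Phi G T)"
proof -
  have "odd (card (A \<inter> sym_diff S T)) \<longleftrightarrow> odd (card (A \<inter> S)) \<noteq> odd (card (A \<inter> T))" for A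
  proof -
    have S: "card (A \<inter> S) = card (A \<inter> (S - T)) + card (A \<inter> (S \<inter> T))"
      using assms by (subst card_Un_disjoint [symmetric]) (auto intro!: arg_cong[where f = card])
    have T: "card (A \<inter> T) = card (A \<inter> (T - S)) + card (A \<inter> (S \<inter> T))"
      using assms by (subst card_Un_disjoint [symmetric]) (auto intro!: arg_cong[where f = card])
    have "card (A \<inter> sym_diff S T) = card (A \<inter> (S - T)) + card (A \<inter> (T - S))"
      using assms by (subst card_Un_disjoint [symmetric]) (auto intro!: arg_cong[where f = card])
    with S T show ?thesis by auto
  qed
  then show ?thesis by (auto simp: Phi_def)
qed

lemma subspace_ker_Phi:
  assumes "finite (pverts G)"
  shows "F2.subspace (char_vec ` ker_Phi G)"
proof (rule F2.subspaceI)
  have 0: "{} \<in> ker_Phi G" by (auto simp: ker_Phi_def Phi_def)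
  have z: "char_vec {} = 0" by (auto simp: char_vec_def fun_eq_iff)
  show "0 \<in> char_vec ` ker_Phi G" using 0 z by (metis image_eqI)
  fix x y assume "x \<in> char_vec ` ker_Phi G" "y \<in> char_vec ` ker_Phi G"
  then obtain S T where ST: "x = char_vec S" "y = char_vec T" "S \<in> ker_Phi G" "T \<in> ker_Phi G"
    by auto
  then have fin: "finite S" "finite T" using assms by (auto simp: ker_Phi_def finite_subset)
  have "sym_diff S T \<in> ker_Phi G"
    using ST Phi_sym_diff[OF fin, of G] by (auto simp: ker_Phi_def)
  then show "x + y \<in> char_vec ` ker_Phi G"
    using ST by (metis char_vec_sym_diff image_eqI)
next
  have 0: "{} \<in> ker_Phi G" by (auto simp: ker_Phi_def Phi_def)
  fix c x assume x: "x \<in> char_vec ` ker_Phi G"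
  show "scale2 c x \<in> char_vec ` ker_Phi G"
  proof (cases c)
    case zero
    then have "scale2 c x = char_vec {}" by (simp add: scale2_def char_vec_def fun_eq_iff)
    then show ?thesis using 0 by blast
  next
    case one
    then show ?thesis using x by (simp only: F2.scale_one)
  qed
qed

lemma d_0: "d 0 = 0"
proof -
  have "char_vec ` ker_Phi (grid_graph 0) = {0}"
    by (auto simp: ker_Phi_def Phi_def grid_graph_def char_vec_def fun_eq_iff)
  then have "d 0 = F2.dim {0 :: nat \<times> nat \<Rightarrow> bit}" by (simp add: d_def)
  also have "\<dots> = card ({} :: (nat \<times> nat \<Rightarrow> bit) set)"
    by (rule F2.dim_eq_card) (simp_all add: F2.independent_empty F2.span_insert_0)
  finally show ?thesis by simp
qed

end

theory Submission
  imports Defs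
begin

text \<open>
  Unfold a kernel vector of the \<open>(n - 1) \<times> (n - 1)\<close> grid across the lines whose index is a multiple
  of \<open>n\<close> by repeated reflection, putting 0 on those lines. Off the lines, a cell sees a mirror image
  of a neighbourhood in the small grid; on a line, the two neighbours across it are mirror images and
  cancel modulo 2. Restricting to \<open>{1..n * k - 1}\<^sup>2\<close> cuts along such lines, so this gives an
  injective linear map between the kernels.
\<close>

text \<open>For positive \<open>n\<close> this is the distance from \<open>i\<close> to the nearest
  multiple of \<open>2 * n\<close>: the triangle wave generated by reflections in the multiples of
  \<open>n\<close>.\<close>

definition fold_coord :: "nat \<Rightarrow> nat \<Rightarrow> nat" where
  "fold_coord n i = (if i mod (2 * n) \<le> n then i mod (2 * n) else 2 * n - i mod (2 * n))"

lemma fold_coord_id: "i < n \<Longrightarrow> fold_coord n i = i"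
  by (auto simp: fold_coord_def)

lemma fold_coord_mult: "fold_coord n (n * k) = 0 \<or> fold_coord n (n * k) = n"
proof (cases "even k")
  case True
  then obtain l where "k = 2 * l" by blast
  then have "n * k = 2 * n * l" by simp
  then have "n * k mod (2 * n) = 0" by (simp only: mod_mult_self1_is_0)
  then show ?thesis by (simp add: fold_coord_def)
next
  case False
  then obtain l where "k = 2 * l + 1" by (elim oddE)
  then have "n * k = n + 2 * n * l" by (simp add: algebra_simps)
  then have "n * k mod (2 * n) = n mod (2 * n)" by (simp only: mod_mult_self2)
  then show ?thesis by (cases "n = 0") (simp_all add: fold_coord_def)
qed

text \<open>The wave has slope 1 or -1 between consecutive multiples of \<open>n\<close> and turns
  at each of them. The slope decides in which order the two neighbours of \<open>a\<close>
  appear.\<close>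

lemma fold_coord_neighbours:
  fixes n i :: nat
  assumes "n > 0"
  defines "a \<equiv> fold_coord n (Suc i)"
  shows "(a = 0 \<or> a = n) \<and> fold_coord n i = fold_coord n (Suc (Suc i))
    \<or> 0 < a \<and> a < n \<and> (fold_coord n i = a - 1 \<and> fold_coord n (Suc (Suc i)) = a + 1
                     \<or> fold_coord n i = a + 1 \<and> fold_coord n (Suc (Suc i)) = a - 1)"
proof -
  have "i mod (2 * n) < 2 * n" using assms by simp
  then show ?thesis
    using assms unfolding a_def fold_coord_def mod_Suc [of "Suc i"] mod_Suc [of i]
    by (auto split: if_splits)
qed

lemma sum_five_distinct:
  fixes h :: "'a \<Rightarrow> 'b::comm_monoid_add"
  assumes "distinct [a, b, c, x, y]"
  shows "sum h {a, b, c, x, y} = h a + (h b + h c) + (h x + h y)"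
  using assms by (simp add: add.assoc)

text \<open>Oddness of a count is nonvanishing in \<open>bit\<close>. Since the vector is 0 off the
  grid, one five-term equation serves border and inner cells alike. Opposite neighbours share a
  bracket so that they can cancel as a pair.\<close>

lemma char_vec_ker_Phi_grid_iff:
  "g \<in> char_vec ` ker_Phi (grid_graph m) \<longleftrightarrow>
    (\<forall>p. p \<notin> {1..m} \<times> {1..m} \<longrightarrow> g p = 0) \<and>
    (\<forall>i\<in>{1..m}. \<forall>j\<in>{1..m}. g (i, j) + (g (i - 1, j) + g (i + 1, j)) + (g (i, j - 1) + g (i, j + 1)) = 0)"
  (is "_ \<longleftrightarrow> ?supp g \<and> ?eqs g")
proof -
  have nbhd_sum: "of_nat (card (closed_nbhd (grid_graph m) (i, j) \<inter> S)) =
      char_vec S (i, j) + (char_vec S (i - 1, j) + char_vec S (i + 1, j))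
      + (char_vec S (i, j - 1) + char_vec S (i, j + 1))"
    if S: "S \<subseteq> {1..m} \<times> {1..m}" and ij: "i \<in> {1..m}" "j \<in> {1..m}" for S i j
  proof -
    let ?N = "{(i, j), (i - 1, j), (i + 1, j), (i, j - 1), (i, j + 1)}"
    \<comment> \<open>Cells of \<open>?N\<close> beyond the grid are discarded by intersecting with
      \<open>S\<close>.\<close>
    have "closed_nbhd (grid_graph m) (i, j) \<inter> S = ?N \<inter> S"
      using S ij by (auto simp: closed_nbhd_def grid_graph_def)
    then have "of_nat (card (closed_nbhd (grid_graph m) (i, j) \<inter> S)) = (\<Sum>p\<in>?N \<inter> S. 1 :: bit)"
      by simp
    also have "\<dots> = (\<Sum>p\<in>?N. char_vec S p)"
      by (rule sum.mono_neutral_cong_left) (auto simp: char_vec_def)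
    also have "\<dots> = char_vec S (i, j) + (char_vec S (i - 1, j) + char_vec S (i + 1, j))
      + (char_vec S (i, j - 1) + char_vec S (i, j + 1))"
      \<comment> \<open>Distinctness uses \<open>i, j \<ge> 1\<close>: truncated subtraction would
        identify \<open>i - 1\<close> with \<open>i\<close> at 0.\<close>
      by (rule sum_five_distinct) (use ij in auto)
    finally show ?thesis .
  qed
  have odd_iff: "odd c \<longleftrightarrow> of_nat c \<noteq> (0 :: bit)" for c :: nat
    by (induction c) auto
  have ker_iff: "S \<in> ker_Phi (grid_graph m) \<longleftrightarrow> S \<subseteq> {1..m} \<times> {1..m} \<and> ?eqs (char_vec S)" for S
  proof (cases "S \<subseteq> {1..m} \<times> {1..m}")
    case True
    then have "Phi (grid_graph m) S = {} \<longleftrightarrow>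
        (\<forall>i\<in>{1..m}. \<forall>j\<in>{1..m}. of_nat (card (closed_nbhd (grid_graph m) (i, j) \<inter> S)) = (0 :: bit))"
      unfolding Phi_def odd_iff by (auto simp: grid_graph_def)
    with True nbhd_sum [OF True] show ?thesis
      by (simp add: ker_Phi_def grid_graph_def)
  next
    case False
    then show ?thesis by (auto simp: ker_Phi_def grid_graph_def)
  qed
  have char: "g = char_vec {p. g p \<noteq> 0}"
    by (auto simp: char_vec_def fun_eq_iff)
  have supp: "?supp (char_vec S) \<longleftrightarrow> S \<subseteq> {1..m} \<times> {1..m}" for S
    by (simp only: char_vec_def subset_iff of_bool_eq_0_iff) blast
  show ?thesis
  proof
    assume "g \<in> char_vec ` ker_Phi (grid_graph m)"
    then show "?supp g \<and> ?eqs g" using ker_iff supp by blast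
  next
    assume "?supp g \<and> ?eqs g"
    then have "{p. g p \<noteq> 0} \<in> ker_Phi (grid_graph m)"
      unfolding ker_iff supp [symmetric] char [symmetric] by blast
    then show "g \<in> char_vec ` ker_Phi (grid_graph m)" using char by blast
  qed
qed

text \<open>The zeros on the fold lines come from \<open>f\<close> itself: folded coordinates 0 and
  \<open>n\<close> lie outside the grid of side \<open>n - 1\<close>.\<close>

definition unfold_vec :: "nat \<Rightarrow> nat \<Rightarrow> (nat \<times> nat \<Rightarrow> bit) \<Rightarrow> nat \<times> nat \<Rightarrow> bit" where
  "unfold_vec n m f = (\<lambda>(i, j). if (i, j) \<in> {1..m} \<times> {1..m}
     then f (fold_coord n i, fold_coord n j) else 0)"

lemma unfold_vec_in_ker:
  assumes "n > 0" "k > 0" and f: "f \<in> char_vec ` ker_Phi (grid_graph (n - 1))"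
  shows "unfold_vec n (n * k - 1) f \<in> char_vec ` ker_Phi (grid_graph (n * k - 1))"
  unfolding char_vec_ker_Phi_grid_iff
proof (intro conjI allI impI ballI)
  let ?m = "n * k - 1"
  fix p assume "p \<notin> {1..?m} \<times> {1..?m}"
  then show "unfold_vec n ?m f p = 0" by (auto simp: unfold_vec_def split: prod.split)
next
  let ?m = "n * k - 1" and ?c = "fold_coord n"
  let ?g = "unfold_vec n ?m f"
  have f0: "f (a, b) = 0" if "a = 0 \<or> a = n \<or> b = 0 \<or> b = n" for a b
  proof -
    have "(a, b) \<notin> {1..n - 1} \<times> {1..n - 1}" using that assms(1) by auto
    then show ?thesis using f unfolding char_vec_ker_Phi_grid_iff by blast
  qed
  have feq: "f (a, b) + (f (a - 1, b) + f (a + 1, b)) + (f (a, b - 1) + f (a, b + 1)) = 0"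
    if "0 < a" "a < n" "0 < b" "b < n" for a b
    using f that unfolding char_vec_ker_Phi_grid_iff by auto
  have bd: "?c i = 0 \<or> ?c i = n" if "i \<le> ?m + 1" "i \<notin> {1..?m}" for i
  proof -
    have "i = 0 \<or> i = n * k" using that assms(1,2) by (auto simp: not_le)
    then show ?thesis using fold_coord_mult [of n k] fold_coord_id [of 0 n] assms(1) by auto
  qed
  have g: "?g (i, j) = f (?c i, ?c j)" if "i \<le> ?m + 1" "j \<le> ?m + 1" for i j
    using bd [of i] bd [of j] that f0 [of "?c i" "?c j"] by (auto simp: unfold_vec_def)
  fix i j assume "i \<in> {1..?m}" "j \<in> {1..?m}"
  then obtain i' j' where ij: "i = Suc i'" "j = Suc j'" "Suc i' \<le> ?m" "Suc j' \<le> ?m"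
    by (cases i; cases j) auto
  let ?a = "?c (Suc i')" and ?b = "?c (Suc j')"
  have gs: "?g (i, j) = f (?a, ?b)" "?g (i - 1, j) = f (?c i', ?b)" "?g (i + 1, j) = f (?c (Suc (Suc i')), ?b)"
    "?g (i, j - 1) = f (?a, ?c j')" "?g (i, j + 1) = f (?a, ?c (Suc (Suc j')))"
    using g [of "Suc i'" "Suc j'"] g [of i' "Suc j'"] g [of "Suc (Suc i')" "Suc j'"]
      g [of "Suc i'" j'] g [of "Suc i'" "Suc (Suc j')"] ij by simp_all
  note ci = fold_coord_neighbours [OF assms(1), of i'] and cj = fold_coord_neighbours [OF assms(1), of j']
  consider "?a = 0 \<or> ?a = n" | "?b = 0 \<or> ?b = n" | "0 < ?a" "?a < n" "0 < ?b" "?b < n"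
    using ci cj by blast
  then show "?g (i, j) + (?g (i - 1, j) + ?g (i + 1, j)) + (?g (i, j - 1) + ?g (i, j + 1)) = 0"
  proof cases
    case 1
    \<comment> \<open>The neighbours across the line are equal and cancel in \<open>bit\<close>; the
      cell and its neighbours along the line carry 0.\<close>
    then have "?c i' = ?c (Suc (Suc i'))" using ci by auto
    moreover have "f (?a, x) = 0" for x using 1 f0 by blast
    ultimately show ?thesis unfolding gs by simp
  next
    case 2
    then have "?c j' = ?c (Suc (Suc j'))" using cj by auto
    moreover have "f (x, ?b) = 0" for x using 2 f0 by blast
    ultimately show ?thesis unfolding gs by simp
  next
    case 3
    \<comment> \<open>A reflection may swap the two neighbours, which leaves their sum
      unchanged.\<close>
    have "f (?c i', ?b) + f (?c (Suc (Suc i')), ?b) = f (?a - 1, ?b) + f (?a + 1, ?b)"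
      using ci 3 by (auto simp: add.commute)
    moreover have "f (?a, ?c j') + f (?a, ?c (Suc (Suc j'))) = f (?a, ?b - 1) + f (?a, ?b + 1)"
      using cj 3 by (auto simp: add.commute)
    ultimately show ?thesis unfolding gs using feq [OF 3] by simp
  qed
qed

text \<open>Folding fixes coordinates below \<open>n\<close>, so the unfolded vector still shows the
  original on the first block, and kernel vectors vanish elsewhere.\<close>

lemma inj_on_unfold_vec:
  assumes "n > 0" "k > 0"
  shows "inj_on (unfold_vec n (n * k - 1)) (char_vec ` ker_Phi (grid_graph (n - 1)))"
proof (rule inj_onI, rule ext)
  fix f g :: "nat \<times> nat \<Rightarrow> bit" and p :: "nat \<times> nat"
  assume f: "f \<in> char_vec ` ker_Phi (grid_graph (n - 1))"
    and g: "g \<in> char_vec ` ker_Phi (grid_graph (n - 1))"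
    and eq: "unfold_vec n (n * k - 1) f = unfold_vec n (n * k - 1) g"
  obtain i j where p: "p = (i, j)" by fastforce
  show "f p = g p"
  proof (cases "p \<in> {1..n - 1} \<times> {1..n - 1}")
    case True
    have "n - 1 \<le> n * k - 1" using assms by (intro diff_le_mono) simp
    then have "i \<in> {1..n * k - 1}" "j \<in> {1..n * k - 1}" "i < n" "j < n"
      using True p by auto
    then show ?thesis
      using fun_cong [OF eq, of "(i, j)"] by (simp add: unfold_vec_def fold_coord_id p)
  next
    case False
    then have "f p = 0" "g p = 0" using f g unfolding char_vec_ker_Phi_grid_iff by blast+
    then show ?thesis by simp
  qed
qed

theorem theorem2:
  fixes n k :: nat
  assumes "n > 0" and "k > 0"
  shows "d (n * k - 1) \<ge> d (n - 1)"
proof -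
  let ?U = "\<lambda>m. char_vec ` ker_Phi (grid_graph m)" and ?T = "unfold_vec n (n * k - 1)"
  interpret P: vector_space_pair "scale2 :: bit \<Rightarrow> (nat \<times> nat \<Rightarrow> bit) \<Rightarrow> _"
    "scale2 :: bit \<Rightarrow> (nat \<times> nat \<Rightarrow> bit) \<Rightarrow> _"
    by unfold_locales
  have fin: "finite (?U m)" for m
    by (rule finite_imageI, rule finite_subset [of _ "Pow ({1..m} \<times> {1..m})"])
      (auto simp: ker_Phi_def grid_graph_def)
  have sub: "F2.subspace (?U (n - 1))"
    by (rule subspace_ker_Phi) (simp add: grid_graph_def)
  have lin: "Vector_Spaces.linear scale2 scale2 ?T"
    by unfold_locales (auto simp: unfold_vec_def scale2_def fun_eq_iff)
  obtain B where B: "B \<subseteq> ?U (n - 1)" "F2.independent B" "card B = d (n - 1)"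
    using F2.basis_exists [of "?U (n - 1)"] unfolding d_def by metis
  obtain C where C: "C \<subseteq> ?U (n * k - 1)" "?U (n * k - 1) \<subseteq> F2.span C" "card C = d (n * k - 1)"
    using F2.basis_exists [of "?U (n * k - 1)"] unfolding d_def by metis
  \<comment> \<open>Preserving independence of \<open>B\<close> requires injectivity on its whole
    span, which stays inside the kernel.\<close>
  have "F2.span B \<subseteq> ?U (n - 1)"
    using B(1) sub by (rule F2.span_minimal)
  then have inj: "inj_on ?T (F2.span B)"
    using inj_on_unfold_vec [OF assms] inj_on_subset by blast
  have "F2.independent (?T ` B)"
    using lin B(2) inj by (rule P.linear_independent_injective_image)
  moreover have "?T ` B \<subseteq> F2.span C"
    using B(1) C(2) unfold_vec_in_ker [OF assms] by blast
  \<comment> \<open>Finiteness lets the exchange bound compare the independent image of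
    \<open>B\<close> with the spanning set \<open>C\<close>.\<close>
  moreover have "finite C"
    using C(1) fin by (rule finite_subset)
  ultimately have "card (?T ` B) \<le> card C"
    using F2.independent_span_bound by blast
  moreover have "card (?T ` B) = card B"
    using inj F2.span_superset [of B] by (meson card_image inj_on_subset)
  ultimately show ?thesis using B(3) C(3) by simp
qed

end
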